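(* Let $\langle\varphi_i\rangle_{i\in\mathbb{N}}$ be a sequence of lower semicontinuous submeasures on $\mathbb{N}$, and let $\mathcal{I}=\mathrm{Exh}_{\langle\varphi_i\rangle}=\{X\subseteq\mathbb{N}:\limsup_{i\to\infty}\varphi_i(X)=0\}$. Then the equivalence relation $\mathsf{E}_{\mathcal{I}}$ on $\mathcal{P}(\mathbb{N})$, given by $x\,\mathsf{E}_{\mathcal{I}}\,y$ iff $x\triangle y\in\mathcal{I}$, is pinned.
   Context: A submeasure on $\mathbb{N}$ is a map $\varphi:\mathcal{P}(\mathbb{N})\to[0,+\infty]$ with $\varphi(\emptyset)=0$, $\varphi(\{a\})<+\infty$ for all $a$, and $\varphi(x)\le\varphi(x\cup y)\le\varphi(x)+\varphi(y)$; it is lower semicontinuous if $\varphi(x)=\sup_n\varphi(x\cap[0,n))$ for all $x$. $\mathcal{P}(\mathbb{N})$ is identified with the Polish space $2^{\mathbb{N}}$. Pinned relations: let $V$ be the set-theoretic universe. For an analytic set or relation $A$ defined in $V$ and a generic extension $V'$, $A^*$ denotes the result of applying the same definition in $V'$. Let $\mathsf{E}$ be an analytic equivalence relation on a Polish space $\mathbb{X}$ and $\mathbb{P}$ a forcing notion. A virtual $\mathsf{E}$-class is a $\mathbb{P}$-name $\xi$ such that $\mathbb{P}$ forces $\xi\in\mathbb{X}^*$ and $\mathbb{P}\times\mathbb{P}$ forces $\xi_{\mathrm{left}}\,\mathsf{E}^*\,\xi_{\mathrm{right}}$, where $\xi_{\mathrm{left}},\xi_{\mathrm{right}}$ are the $\mathbb{P}\times\mathbb{P}$-names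 interpreting $\xi$ via the left, resp. right, generic factor. It is pinned if there is $x\in\mathbb{X}$ in $V$ such that $\mathbb{P}$ forces $x\,\mathsf{E}^*\,\xi$. $\mathsf{E}$ is pinned if for every forcing notion $\mathbb{P}$ every virtual $\mathsf{E}$-class is pinned. *)

theory Defs
  imports "HOL-Library.Extended_Nonnegative_Real"
begin

subsection \<open>Submeasures, exhaustive ideals and their equivalence relations\<close>

definition submeasure :: "(nat set \<Rightarrow> ennreal) \<Rightarrow> bool" where
  "submeasure \<phi> \<longleftrightarrow>
     \<phi> {} = 0 \<and> (\<forall>a. \<phi> {a} < \<infinity>) \<and>
     (\<forall>x y. \<phi> x \<le> \<phi> (x \<union> y) \<and> \<phi> (x \<union> y) \<le> \<phi> x + \<phi> y)"

definition lower_semicontinuous :: "(nat set \<Rightarrow> ennreal) \<Rightarrow> bool" where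
  "lower_semicontinuous \<phi> \<longleftrightarrow> (\<forall>x. \<phi> x = (SUP n. \<phi> (x \<inter> {..<n})))"

definition Exh :: "(nat \<Rightarrow> nat set \<Rightarrow> ennreal) \<Rightarrow> nat set set" where
  "Exh \<phi> = {X. limsup (\<lambda>i. \<phi> i X) = 0}"

definition E_of :: "nat set set \<Rightarrow> (nat set \<times> nat set) set" where
  "E_of I = {(x, y). sym_diff x y \<in> I}"


subsection \<open>Analytic relations on the power set of the naturals\<close>

text \<open>
  An analytic subset of \<open>2\<^sup>\<nat> \<times> 2\<^sup>\<nat>\<close> is the projection of a closed subset of
  \<open>2\<^sup>\<nat> \<times> 2\<^sup>\<nat> \<times> \<nat>\<^sup>\<nat>\<close>. The closed set is given by a set \<open>T\<close> of triples of finite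
  sequences: a point belongs to it iff all its restrictions to initial segments \<open>{0..<n}\<close>
  lie in \<open>T\<close>. Such a \<open>T\<close> is the ``definition'' of the analytic relation which is
  re-evaluated in generic extensions.
\<close>

type_synonym code = "(bool list \<times> bool list \<times> nat list) set"

definition char_seq :: "nat set \<Rightarrow> nat \<Rightarrow> bool list" where
  "char_seq x n = map (\<lambda>i. i \<in> x) [0..<n]"

definition projection :: "code \<Rightarrow> (nat set \<times> nat set) set" where
  "projection T = {(x, y). \<exists>z :: nat \<Rightarrow> nat. \<forall>n. (char_seq x n, char_seq y n, map z [0..<n]) \<in> T}"

definition analytic :: "(nat set \<times> nat set) set \<Rightarrow> bool" where
  "analytic E \<longleftrightarrow> (\<exists>T. E = projection T)"


subsection \<open>Forcing\<close>

text \<open>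
  A forcing notion is a nonempty preorder \<open>r\<close>; its conditions are the elements of \<open>Field r\<close>,
  and \<open>(q, p) \<in> r\<close> means that \<open>q\<close> is stronger than \<open>p\<close>.
\<close>

definition forcing_notion :: "('p \<times> 'p) set \<Rightarrow> bool" where
  "forcing_notion r \<longleftrightarrow> Preorder r \<and> r \<noteq> {}"

definition prod_forcing :: "('p \<times> 'p) set \<Rightarrow> ('q \<times> 'q) set \<Rightarrow> (('p \<times> 'q) \<times> ('p \<times> 'q)) set" where
  "prod_forcing r s = {((p', q'), (p, q)) | p' q' p q. (p', p) \<in> r \<and> (q', q) \<in> s}"

text \<open>
  A name for a subset of a ground model set \<open>'a\<close> is a set of pairs \<open>(a, p)\<close> with \<open>p\<close> a
  condition; its value by a generic filter \<open>G\<close> is \<open>{a. \<exists>p\<in>G. (a, p) \<in> \<xi>}\<close>. Every name that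
  is forced to be a subset of \<open>'a\<close> is forced to be equal to a name of this form.
\<close>

type_synonym ('a, 'p) name = "('a \<times> 'p) set"

definition is_name :: "('p \<times> 'p) set \<Rightarrow> ('a, 'p) name \<Rightarrow> bool" where
  "is_name r \<xi> \<longleftrightarrow> \<xi> \<subseteq> UNIV \<times> Field r"

definition check_name :: "('p \<times> 'p) set \<Rightarrow> 'a set \<Rightarrow> ('a, 'p) name" where
  "check_name r x = x \<times> Field r"

definition left_name :: "('q \<times> 'q) set \<Rightarrow> ('a, 'p) name \<Rightarrow> ('a, 'p \<times> 'q) name" where
  "left_name s \<xi> = {(a, (p, q)) | a p q. (a, p) \<in> \<xi> \<and> q \<in> Field s}"

definition right_name :: "('p \<times> 'p) set \<Rightarrow> ('a, 'q) name \<Rightarrow> ('a, 'p \<times> 'q) name" where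
  "right_name r \<xi> = {(a, (p, q)) | a p q. p \<in> Field r \<and> (a, q) \<in> \<xi>}"

definition dense_below :: "('p \<times> 'p) set \<Rightarrow> 'p \<Rightarrow> 'p set \<Rightarrow> bool" where
  "dense_below r p D \<longleftrightarrow> (\<forall>q. (q, p) \<in> r \<longrightarrow> (\<exists>d\<in>D. (d, q) \<in> r))"

text \<open>
  The forcing relation, by the usual clauses for atomic formulas, negation, conjunction and
  existential quantification.
\<close>

definition forces_mem :: "('p \<times> 'p) set \<Rightarrow> 'p \<Rightarrow> 'a \<Rightarrow> ('a, 'p) name \<Rightarrow> bool" where
  "forces_mem r p a \<xi> \<longleftrightarrow> dense_below r p {q. \<exists>s. (a, s) \<in> \<xi> \<and> (q, s) \<in> r}"

definition forces_not_mem :: "('p \<times> 'p) set \<Rightarrow> 'p \<Rightarrow> 'a \<Rightarrow> ('a, 'p) name \<Rightarrow> bool" where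
  "forces_not_mem r p a \<xi> \<longleftrightarrow> (\<forall>q. (q, p) \<in> r \<longrightarrow> \<not> forces_mem r q a \<xi>)"

text \<open>\<open>p\<close> forces that \<open>s\<close> is the restriction of the characteristic function of \<open>\<xi>\<close>.\<close>

definition forces_char_seq :: "('p \<times> 'p) set \<Rightarrow> 'p \<Rightarrow> (nat, 'p) name \<Rightarrow> bool list \<Rightarrow> bool" where
  "forces_char_seq r p \<xi> s \<longleftrightarrow>
     (\<forall>i < length s. if s ! i then forces_mem r p i \<xi> else forces_not_mem r p i \<xi>)"

text \<open>\<open>p\<close> forces that \<open>\<zeta>\<close> is the graph of a function from \<open>\<nat>\<close> to \<open>\<nat>\<close>.\<close>

definition forces_fun :: "('p \<times> 'p) set \<Rightarrow> 'p \<Rightarrow> (nat \<times> nat, 'p) name \<Rightarrow> bool" where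
  "forces_fun r p \<zeta> \<longleftrightarrow>
     (\<forall>i. dense_below r p {q. \<exists>m. forces_mem r q (i, m) \<zeta>}) \<and>
     (\<forall>i m m' q. (q, p) \<in> r \<and> forces_mem r q (i, m) \<zeta> \<and> forces_mem r q (i, m') \<zeta> \<longrightarrow> m = m')"

text \<open>\<open>p\<close> forces that \<open>(\<xi>, \<eta>, \<zeta>)\<close> is a point of the closed set coded by \<open>T\<close>.\<close>

definition forces_branch ::
  "('p \<times> 'p) set \<Rightarrow> code \<Rightarrow> 'p \<Rightarrow> (nat, 'p) name \<Rightarrow> (nat, 'p) name \<Rightarrow> (nat \<times> nat, 'p) name \<Rightarrow> bool"
where
  "forces_branch r T p \<xi> \<eta> \<zeta> \<longleftrightarrow>
     forces_fun r p \<zeta> \<and>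
     (\<forall>n. dense_below r p
        {q. \<exists>(s, t, u)\<in>T. length s = n \<and> length t = n \<and> length u = n \<and>
              forces_char_seq r q \<xi> s \<and> forces_char_seq r q \<eta> t \<and>
              (\<forall>i<n. forces_mem r q (i, u ! i) \<zeta>)})"

text \<open>
  \<open>p\<close> forces \<open>(\<xi>, \<eta>) \<in> (projection T)\<^sup>*\<close>, where \<open>(projection T)\<^sup>*\<close> is the projection, computed in the
  generic extension, of the closed set coded by \<open>T\<close>.
\<close>

definition forces_projection ::
  "('p \<times> 'p) set \<Rightarrow> code \<Rightarrow> 'p \<Rightarrow> (nat, 'p) name \<Rightarrow> (nat, 'p) name \<Rightarrow> bool" where
  "forces_projection r T p \<xi> \<eta> \<longleftrightarrow>
     dense_below r p {q. \<exists>\<zeta>. is_name r \<zeta> \<and> forces_branch r T q \<xi> \<eta> \<zeta>}"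


subsection \<open>Pinned equivalence relations\<close>

text \<open>Every \<open>\<xi>\<close> with \<open>is_name r \<xi>\<close> is automatically forced to be a point of \<open>\<P>(\<nat>)\<close>.\<close>

definition virtual_class :: "('p \<times> 'p) set \<Rightarrow> code \<Rightarrow> (nat, 'p) name \<Rightarrow> bool" where
  "virtual_class r T \<xi> \<longleftrightarrow>
     is_name r \<xi> \<and>
     (\<forall>pq \<in> Field (prod_forcing r r).
        forces_projection (prod_forcing r r) T pq (left_name r \<xi>) (right_name r \<xi>))"

definition pinned_class :: "('p \<times> 'p) set \<Rightarrow> code \<Rightarrow> (nat, 'p) name \<Rightarrow> bool" where
  "pinned_class r T \<xi> \<longleftrightarrow> (\<exists>x. \<forall>p \<in> Field r. forces_projection r T p (check_name r x) \<xi>)"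

text \<open>
  By absoluteness \<open>E\<^sup>*\<close> does not depend on the code chosen for \<open>E\<close>; the definition below demands
  the property for every code of \<open>E\<close>. HOL cannot quantify over types inside a
  definition, so the type of the forcing conditions is a parameter; a theorem in which \<open>'p\<close>
  is a free type variable covers forcing notions on arbitrary types.
\<close>

definition pinned :: "'p itself \<Rightarrow> (nat set \<times> nat set) set \<Rightarrow> bool" where
  "pinned _ E \<longleftrightarrow>
     equiv UNIV E \<and> analytic E \<and>
     (\<forall>T. E = projection T \<longrightarrow>
       (\<forall>r :: ('p \<times> 'p) set. forcing_notion r \<longrightarrow>
         (\<forall>\<xi>. virtual_class r T \<xi> \<longrightarrow> pinned_class r T \<xi>)))"

end

theory Submission
  imports Defs
begin

text \<open>
  If \<open>(p, q)\<close> forces \<open>\<phi>\<^sub>i (\<xi>\<^sub>l \<triangle> \<xi>\<^sub>r) \<le> \<epsilon>\<close> for all \<open>i \<ge> n\<close>, then comparing two copies of \<open>\<xi>\<close> below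
  \<open>p\<close> with a third one below \<open>q\<close> shows that \<open>(p, p)\<close> forces the bound \<open>2\<epsilon>\<close>. Hence there is a decreasing
  sequence \<open>p\<^sub>k\<close> deciding \<open>\<xi>\<close> to be some \<open>x\<close> such that \<open>(p\<^sub>k, p\<^sub>k)\<close> forces the bound \<open>\<epsilon>\<^sub>k\<close> from some
  \<open>n\<^sub>k\<close> on. Then \<open>p\<^sub>k\<close> forces \<open>x\<close> and \<open>\<xi>\<close> to be \<open>\<epsilon>\<^sub>k\<close>-close. Any realization of \<open>\<xi>\<close> is equivalent to one
  below \<open>p\<^sub>k\<close>, for every \<open>k\<close>, and therefore equivalent to \<open>x\<close>.

  An arbitrary code \<open>T\<close> of the relation is handled by absoluteness. The bounds above transfer between the
  forcing language and sequences of conditions meeting countably many dense sets. If \<open>(\<xi>, \<eta>)\<close> is not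
  forced into the projection of \<open>T\<close>, then some condition forces the tree of attempts to find a witness to be
  well-founded, and this is inherited by the value of \<open>(\<xi>, \<eta>)\<close> along such a sequence.
\<close>

section \<open>Generic sequences\<close>

lemma dense_below_mono: "dense_below r p D \<Longrightarrow> D \<subseteq> D' \<Longrightarrow> dense_below r p D'"
  unfolding dense_below_def by blast

lemma length_char_seq [simp]: "length (char_seq x n) = n"
  and nth_char_seq [simp]: "i < n \<Longrightarrow> char_seq x n ! i \<longleftrightarrow> i \<in> x"
  by (auto simp: char_seq_def)

text \<open>Evaluation goes through the forcing relation instead of the pairs of the name, so that a
  sequence can stand in for the filter it generates.\<close>

definition val :: "('p \<times> 'p) set \<Rightarrow> (nat \<Rightarrow> 'p) \<Rightarrow> ('a, 'p) name \<Rightarrow> 'a set" where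
  "val r g \<xi> = {a. \<exists>n. forces_mem r (g n) a \<xi>}"

definition decides :: "('p \<times> 'p) set \<Rightarrow> ('a, 'p) name \<Rightarrow> 'a \<Rightarrow> 'p set" where
  "decides r \<xi> a = {q. forces_mem r q a \<xi> \<or> forces_not_mem r q a \<xi>}"

text \<open>
  The dense sets to be met may depend on conditions occurring earlier in the sequence. This replaces
  genericity over a countable elementary submodel.
\<close>

definition generic_seq ::
  "('p \<times> 'p) set \<Rightarrow> ('p \<Rightarrow> 'p set) set \<Rightarrow> (nat \<Rightarrow> 'p) \<Rightarrow> bool" where
  "generic_seq r \<D> g \<longleftrightarrow> (\<forall>i j. i \<le> j \<longrightarrow> (g j, g i) \<in> r) \<and>
     (\<forall>D\<in>\<D>. \<forall>i. dense_below r (g i) (D (g i)) \<longrightarrow> (\<exists>j. g j \<in> D (g i)))"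

lemma generic_seq_mono: "generic_seq r \<D> g \<Longrightarrow> (i::nat) \<le> j \<Longrightarrow> (g j, g i) \<in> r"
  unfolding generic_seq_def by blast

lemma generic_seq_meets:
  "generic_seq r \<D> g \<Longrightarrow> D \<in> \<D> \<Longrightarrow> dense_below r (g i) (D (g i)) \<Longrightarrow> \<exists>j. g j \<in> D (g i)"
  unfolding generic_seq_def by blast

lemma generic_seq_subset: "generic_seq r \<D> g \<Longrightarrow> \<D>' \<subseteq> \<D> \<Longrightarrow> generic_seq r \<D>' g"
  unfolding generic_seq_def by blast

text \<open>Iterate \<open>\<Phi>\<close> transfinitely from the empty set; an element is ranked by
  the stage at which it first appears. Stages are indexed by a well-order of \<open>'x set\<close>,
  which is too large to inject into \<open>'x\<close>, so the iteration closes off.\<close>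

lemma ranked_prefixpoint:
  fixes \<Phi> :: "'x set \<Rightarrow> 'x set"
  assumes "mono \<Phi>"
  shows "\<exists>W R. wf R \<and> \<Phi> W \<subseteq> W \<and> (\<forall>x\<in>W. x \<in> \<Phi> {y \<in> W. (y, x) \<in> R})"
proof -
  obtain s :: "'x set rel" where s: "well_order_on UNIV s" using well_order_on by blast
  define S where "S = s - Id"
  have wf: "wf S" using s by (simp add: S_def well_order_on_def)
  have total: "(a, b) \<in> S \<or> a = b \<or> (b, a) \<in> S" for a b
    using s unfolding S_def well_order_on_def linear_order_on_def total_on_def by blast
  have trans: "(a, c) \<in> S" if "(a, b) \<in> S" "(b, c) \<in> S" for a b c
    using that s unfolding S_def well_order_on_def linear_order_on_def partial_order_on_def
      preorder_on_def by (auto dest: transD antisymD)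
  define f where "f = wfrec S (\<lambda>f a. \<Phi> (\<Union>b\<in>{b. (b, a) \<in> S}. f b))"
  define U where "U a = (\<Union>b\<in>{b. (b, a) \<in> S}. f b)" for a
  have f: "f a = \<Phi> (U a)" for a
    unfolding f_def U_def by (subst wfrec[OF wf]) (simp add: cut_apply cong: SUP_cong_simp)
  text \<open>The stages cannot grow strictly along a well-order of the power set, by Cantor's theorem.\<close>
  have "\<exists>a. \<Phi> (U a) \<subseteq> U a"
  proof (rule ccontr)
    assume "\<not> ?thesis"
    then have "\<forall>a. \<exists>x. x \<in> \<Phi> (U a) \<and> x \<notin> U a" by blast
    then obtain h where h: "\<And>a. h a \<in> \<Phi> (U a)" "\<And>a. h a \<notin> U a" by metis
    have neq: "h a \<noteq> h b" if "(a, b) \<in> S" for a b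
      using that h(1)[of a, folded f] h(2)[of b] by (auto simp: U_def)
    have "inj h"
    proof (rule injI)
      fix a b assume "h a = h b"
      then show "a = b" using total[of a b] neq[of a b] neq[of b a] by metis
    qed
    then have "range (inv h) = Pow UNIV" using inj_imp_surj_inv by simp
    then show False using Cantors_theorem by blast
  qed
  then obtain a where a: "\<Phi> (U a) \<subseteq> U a" by blast
  \<comment> \<open>Each element of \<open>U a\<close> has a least stage containing it; this stage
    is its rank.\<close>
  have "\<exists>b. x \<in> f b \<and> (\<forall>c. (c, b) \<in> S \<longrightarrow> x \<notin> f c)" if "x \<in> U a" for x
    using that wf_eq_minimal[THEN iffD1, OF wf, rule_format, of _ "{b. x \<in> f b}"]
    unfolding U_def by blast
  then obtain rank where rank: "\<And>x. x \<in> U a \<Longrightarrow> x \<in> f (rank x)"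
    "\<And>x c. x \<in> U a \<Longrightarrow> (c, rank x) \<in> S \<Longrightarrow> x \<notin> f c"
    by metis
  have "x \<in> \<Phi> {y \<in> U a. (y, x) \<in> inv_image S rank}" if x: "x \<in> U a" for x
  proof -
    have "rank x = b \<or> (rank x, b) \<in> S" if "x \<in> f b" for b
      using total[of "rank x" b] rank(2)[OF x, of b] that by blast
    then have "(rank x, a) \<in> S" using x trans unfolding U_def by blast
    \<comment> \<open>Whatever lies in a stage before \<open>rank x\<close> has itself a smaller
      rank, and lies in \<open>U a\<close> because \<open>rank x\<close> precedes
      \<open>a\<close>.\<close>
    then have "y \<in> U a \<and> (rank y, rank x) \<in> S" if y: "y \<in> U (rank x)" for y
    proof -
      obtain b where b: "(b, rank x) \<in> S" "y \<in> f b" using y by (auto simp: U_def)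
      have "(b, a) \<in> S" using b(1) \<open>(rank x, a) \<in> S\<close> by (rule trans)
      then have ya: "y \<in> U a" using b(2) by (auto simp: U_def)
      then show ?thesis using total[of "rank y" b] rank(2)[OF ya, of b] b trans by blast
    qed
    then have "\<Phi> (U (rank x)) \<subseteq> \<Phi> {y \<in> U a. (y, x) \<in> inv_image S rank}"
      by (intro monoD[OF assms]) auto
    then show ?thesis using rank(1)[OF x] unfolding f[of "rank x"] by (rule subsetD)
  qed
  then show ?thesis using a wf by (intro exI[of _ "U a"] exI[of _ "inv_image S rank"]) auto
qed

section \<open>Persistence and decision in a fixed forcing preorder\<close>

locale forcing =
  fixes r :: "('p \<times> 'p) set"
  assumes preorder: "Preorder r"
begin

lemma refl: "p \<in> Field r \<Longrightarrow> (p, p) \<in> r"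
  using preorder by (auto simp: preorder_on_def refl_on_def)

lemma trans: "(p, q) \<in> r \<Longrightarrow> (q, s) \<in> r \<Longrightarrow> (p, s) \<in> r"
  using preorder by (auto simp: preorder_on_def elim: transE)

lemma dense_below_stronger: "dense_below r p D \<Longrightarrow> (q, p) \<in> r \<Longrightarrow> dense_below r q D"
  unfolding dense_below_def by (blast intro: trans)

lemma forces_mem_stronger: "forces_mem r p a \<xi> \<Longrightarrow> (q, p) \<in> r \<Longrightarrow> forces_mem r q a \<xi>"
  unfolding forces_mem_def by (rule dense_below_stronger)

lemma forces_not_mem_stronger:
  "forces_not_mem r p a \<xi> \<Longrightarrow> (q, p) \<in> r \<Longrightarrow> forces_not_mem r q a \<xi>"
  unfolding forces_not_mem_def by (blast intro: trans)

lemma forces_char_seq_stronger: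
  "forces_char_seq r p \<xi> s \<Longrightarrow> (q, p) \<in> r \<Longrightarrow> forces_char_seq r q \<xi> s"
  unfolding forces_char_seq_def
  by (metis forces_mem_stronger forces_not_mem_stronger)

lemma decides_dense: "dense_below r p (decides r \<xi> a)"
  unfolding dense_below_def decides_def
proof (intro allI impI)
  fix q assume q: "(q, p) \<in> r"
  then have "(q, q) \<in> r" by (auto intro: refl FieldI1)
  then show "\<exists>d\<in>{q. forces_mem r q a \<xi> \<or> forces_not_mem r q a \<xi>}. (d, q) \<in> r"
    unfolding forces_not_mem_def by blast
qed

lemma forces_contra:
  "forces_mem r p a \<xi> \<Longrightarrow> forces_not_mem r p a \<xi> \<Longrightarrow> p \<in> Field r \<Longrightarrow> False"
  unfolding forces_not_mem_def by (blast intro: refl)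

lemma forces_char_seq_exists:
  assumes "p \<in> Field r"
  shows "\<exists>q s. (q, p) \<in> r \<and> length s = n \<and> forces_char_seq r q \<xi> s"
proof (induction n)
  case 0
  show ?case using refl[OF assms] by (auto simp: forces_char_seq_def)
next
  case (Suc n)
  then obtain q s where q: "(q, p) \<in> r" "length s = n" "forces_char_seq r q \<xi> s" by blast
  obtain q' where q': "(q', q) \<in> r" "q' \<in> decides r \<xi> n"
    using decides_dense[of q \<xi> n] refl[of q] q(1) unfolding dense_below_def
    by (metis FieldI1)
  have s: "forces_char_seq r q' \<xi> s" using q(3) q'(1) by (rule forces_char_seq_stronger)
  have "forces_char_seq r q' \<xi> (s @ [forces_mem r q' n \<xi>])"
    using s q'(2) q(2)
    by (auto simp: forces_char_seq_def decides_def nth_append less_Suc_eq)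
  moreover have "(q', p) \<in> r" using q' q trans by blast
  ultimately show ?case using q(2) by (intro exI[of _ q'] exI) auto
qed

text \<open>Rasiowa-Sikorski with bookkeeping: step \<open>prod_encode (i, k)\<close> enters the
  \<open>k\<close>-th family evaluated at the \<open>i\<close>-th condition, if that set is dense
  below it.\<close>

lemma generic_seq_exists:
  assumes p: "p \<in> Field r" and \<D>: "countable \<D>"
  obtains g where "g 0 = p" "generic_seq r \<D> g"
proof -
  define E where "E = from_nat_into (insert (\<lambda>_. UNIV) \<D>)"
  have E: "\<exists>k. D = E k" if "D \<in> \<D>" for D
    using from_nat_into_surj[of "insert (\<lambda>_. UNIV) \<D>" D] \<D> that by (auto simp: E_def)
  text \<open>The finite history is carried along, since step \<open>n\<close> may refer to an earlier condition.\<close>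
  define ok where "ok h n q \<longleftrightarrow> (let (i, k) = prod_decode n in
      (q, h n) \<in> r \<and> (i \<le> n \<longrightarrow> dense_below r (h i) (E k (h i)) \<longrightarrow> q \<in> E k (h i)))"
    for h :: "nat \<Rightarrow> 'p" and n q
  have step: "\<exists>q. ok h n q" if h: "\<forall>i j. i \<le> j \<longrightarrow> j \<le> n \<longrightarrow> (h j, h i) \<in> r"
    for h :: "nat \<Rightarrow> 'p" and n
  proof -
    obtain i k where ik: "prod_decode n = (i, k)" by force
    show ?thesis
    proof (cases "i \<le> n \<and> dense_below r (h i) (E k (h i))")
      case True
      then show ?thesis using h ik unfolding ok_def dense_below_def by fastforce
    next
      case False
      then show ?thesis using h ik unfolding ok_def by fastforce
    qed
  qed
  have "\<exists>H. \<forall>n. (H n 0 = p \<and> (\<forall>i j. i \<le> j \<longrightarrow> j \<le> n \<longrightarrow> (H n j, H n i) \<in> r)) \<and>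
      ((\<forall>i\<le>n. H (Suc n) i = H n i) \<and> ok (H n) n (H (Suc n) (Suc n)))"
  proof (rule dependent_nat_choice)
    show "\<exists>h::nat \<Rightarrow> 'p. h 0 = p \<and> (\<forall>i j. i \<le> j \<longrightarrow> j \<le> 0 \<longrightarrow> (h j, h i) \<in> r)"
      using refl[OF p] by (intro exI[of _ "\<lambda>_. p"]) auto
  next
    fix h :: "nat \<Rightarrow> 'p" and n assume h: "h 0 = p \<and> (\<forall>i j. i \<le> j \<longrightarrow> j \<le> n \<longrightarrow> (h j, h i) \<in> r)"
    then obtain q where q: "ok h n q" using step by blast
    then have qn: "(q, h n) \<in> r" by (auto simp: ok_def split: prod.splits)
    have "(q, h i) \<in> r" if "i \<le> n" for i using that h qn trans by blast
    moreover have "(q, q) \<in> r" using qn by (auto intro: refl FieldI1)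
    ultimately show "\<exists>h'. (h' 0 = p \<and> (\<forall>i j. i \<le> j \<longrightarrow> j \<le> Suc n \<longrightarrow> (h' j, h' i) \<in> r)) \<and>
        ((\<forall>i\<le>n. h' i = h i) \<and> ok h n (h' (Suc n)))"
      using h q by (intro exI[of _ "h(Suc n := q)"]) (auto simp: le_Suc_eq)
  qed
  then obtain H where H: "\<And>n. (H n 0 = p \<and> (\<forall>i j. i \<le> j \<longrightarrow> j \<le> n \<longrightarrow> (H n j, H n i) \<in> r)) \<and>
      ((\<forall>i\<le>n. H (Suc n) i = H n i) \<and> ok (H n) n (H (Suc n) (Suc n)))"
    by (elim exE) metis
  have H0: "H n 0 = p" and Hok: "ok (H n) n (H (Suc n) (Suc n))" for n using H[of n] by simp_all
  have Hm: "(H n j, H n i) \<in> r" if "i \<le> j" "j \<le> n" for n i j using H[of n] that by simp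
  have HS: "H (Suc n) i = H n i" if "i \<le> n" for n i using H[of n] that by simp
  \<comment> \<open>Each history extends the previous one, so the diagonal agrees with all of
    them.\<close>
  define g where "g n = H n n" for n
  have Hg: "H n i = g i" if "i \<le> n" for n i
    using that by (induction n rule: dec_induct) (auto simp: g_def HS)
  have ok: "ok g n (g (Suc n))" for n
  proof -
    have "ok (H n) n q = ok g n q" for q
      unfolding ok_def by (auto simp: Hg split: prod.splits)
    then show ?thesis using Hok[of n] by (simp add: g_def)
  qed
  show thesis
  proof
    show "g 0 = p" by (simp add: g_def H0)
    show "generic_seq r \<D> g"
      unfolding generic_seq_def
    proof (intro conjI allI impI ballI)
      fix i j :: nat assume "i \<le> j"
      then show "(g j, g i) \<in> r" using Hm[of i j j] by (simp add: Hg)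
    next
      fix D i assume D: "D \<in> \<D>" and dense: "dense_below r (g i) (D (g i))"
      then obtain k where k: "D = E k" using E by blast
      let ?n = "prod_encode (i, k)"
      \<comment> \<open>A pair code is at least its first component, so \<open>g i\<close> is
        already available at step \<open>?n\<close>.\<close>
      have "i \<le> ?n" by (rule le_prod_encode_1)
      then show "\<exists>j. g j \<in> D (g i)"
        using ok[of ?n] dense k by (auto simp: ok_def)
    qed
  qed
qed

lemma generic_seq_in_Field: "generic_seq r \<D> g \<Longrightarrow> g i \<in> Field r"
  using generic_seq_mono[of r \<D> g i i] by (auto intro: FieldI1)

text \<open>Truth lemma for initial segments: every bit is decided somewhere along the sequence, and
  finitely many decisions are combined at a later condition.\<close>

lemma generic_seq_char_seq:
  assumes g: "generic_seq r \<D> g" and dec: "\<And>a. (\<lambda>_. decides r \<xi> a) \<in> \<D>"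
  shows "\<exists>j. forces_char_seq r (g j) \<xi> (char_seq (val r g \<xi>) n)"
proof (induction n)
  case 0
  show ?case by (simp add: forces_char_seq_def)
next
  case (Suc n)
  then obtain j where j: "forces_char_seq r (g j) \<xi> (char_seq (val r g \<xi>) n)" by blast
  obtain i where i: "g i \<in> decides r \<xi> n"
    using generic_seq_meets[OF g dec decides_dense] by blast
  have n: "if n \<in> val r g \<xi> then forces_mem r (g m) n \<xi> else forces_not_mem r (g m) n \<xi>"
    if "i \<le> m" for m
  proof (cases "n \<in> val r g \<xi>")
    case True
    then obtain k where "forces_mem r (g k) n \<xi>" by (auto simp: val_def)
    \<comment> \<open>A condition below \<open>g i\<close> forces membership, so the decision at
      \<open>g i\<close> was not negative.\<close>
    then have "forces_mem r (g (max i k)) n \<xi>"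
      using generic_seq_mono[OF g] forces_mem_stronger by (metis max.cobounded2)
    then have "\<not> forces_not_mem r (g i) n \<xi>"
      using forces_contra forces_not_mem_stronger generic_seq_mono[OF g] generic_seq_in_Field[OF g]
      by (metis max.cobounded1)
    then have "forces_mem r (g i) n \<xi>" using i by (auto simp: decides_def)
    then show ?thesis using True that forces_mem_stronger generic_seq_mono[OF g] by metis
  next
    case False
    then have "forces_not_mem r (g i) n \<xi>" using i by (auto simp: decides_def val_def)
    then show ?thesis using False that forces_not_mem_stronger generic_seq_mono[OF g] by metis
  qed
  let ?m = "max i j"
  have "forces_char_seq r (g ?m) \<xi> (char_seq (val r g \<xi>) n)"
    using j generic_seq_mono[OF g, of j ?m] forces_char_seq_stronger by auto
  then have "forces_char_seq r (g ?m) \<xi> (char_seq (val r g \<xi>) (Suc n))"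
    using n[of ?m] by (auto simp: forces_char_seq_def less_Suc_eq)
  then show ?case by blast
qed

lemma forces_char_seq_unique:
  assumes "forces_char_seq r p \<xi> s" "forces_char_seq r p \<xi> t" "length s = length t" "p \<in> Field r"
  shows "s = t"
proof (rule nth_equalityI)
  fix i assume "i < length s"
  then show "s ! i = t ! i"
    using assms forces_contra unfolding forces_char_seq_def by metis
qed (fact assms(3))

text \<open>The given segment and the true one are both forced by a common later condition, which
  cannot force two different segments of equal length.\<close>

lemma generic_seq_char_seq_eq:
  assumes g: "generic_seq r \<D> g" and dec: "\<And>a. (\<lambda>_. decides r \<xi> a) \<in> \<D>"
    and s: "forces_char_seq r (g i) \<xi> s"
  shows "s = char_seq (val r g \<xi>) (length s)"
proof -
  obtain j where "forces_char_seq r (g j) \<xi> (char_seq (val r g \<xi>) (length s))"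
    using generic_seq_char_seq[OF g dec] by blast
  then have "forces_char_seq r (g (max i j)) \<xi> (char_seq (val r g \<xi>) (length s))"
    "forces_char_seq r (g (max i j)) \<xi> s"
    using s generic_seq_mono[OF g] forces_char_seq_stronger
    by (metis max.cobounded2, metis max.cobounded1)
  then show ?thesis
    using forces_char_seq_unique generic_seq_in_Field[OF g] by (metis length_char_seq)
qed


section \<open>Absoluteness of analytic relations\<close>

text \<open>Evaluate a name for the witness along a sequence which, besides the families in
  \<open>\<D>\<close>, meets the dense sets placing longer and longer segments in
  \<open>T\<close>.\<close>

lemma forces_projection_generic:
  assumes F: "forces_projection r T p \<xi> \<eta>" and p: "p \<in> Field r" and \<D>: "countable \<D>"
  obtains g where "generic_seq r \<D> g" "(g 0, p) \<in> r" "(val r g \<xi>, val r g \<eta>) \<in> projection T"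
proof -
  obtain q \<zeta> where q: "(q, p) \<in> r" and B: "forces_branch r T q \<xi> \<eta> \<zeta>"
    using F refl[OF p] unfolding forces_projection_def dense_below_def by blast
  define B' where "B' n = {q. \<exists>(s, t, u)\<in>T. length s = n \<and> length t = n \<and> length u = n \<and>
              forces_char_seq r q \<xi> s \<and> forces_char_seq r q \<eta> t \<and>
              (\<forall>i<n. forces_mem r q (i, u ! i) \<zeta>)}" for n
  have B'_dense: "dense_below r q (B' n)" for n
    using B unfolding forces_branch_def B'_def by blast
  define \<D>' where "\<D>' = \<D> \<union> range (\<lambda>a _. decides r \<xi> a) \<union> range (\<lambda>a _. decides r \<eta> a) \<union>
    range (\<lambda>n _. B' n)"
  have "countable \<D>'" using \<D> by (auto simp: \<D>'_def)
  then obtain g where g0: "g 0 = q" and g: "generic_seq r \<D>' g"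
    using generic_seq_exists[of q] q by (metis FieldI1)
  have dec: "\<And>a. (\<lambda>_. decides r \<xi> a) \<in> \<D>'" "\<And>a. (\<lambda>_. decides r \<eta> a) \<in> \<D>'"
    "\<And>n. (\<lambda>_. B' n) \<in> \<D>'"
    by (auto simp: \<D>'_def)
  have met: "\<exists>j. g j \<in> B' n" for n
    using generic_seq_meets[OF g dec(3), of 0] B'_dense g0 by blast
  have ex: "\<exists>u j. length u = n \<and> (char_seq (val r g \<xi>) n, char_seq (val r g \<eta>) n, u) \<in> T \<and>
      (\<forall>i<n. forces_mem r (g j) (i, u ! i) \<zeta>)" for n
  proof -
    obtain j s t u where B: "(s, t, u) \<in> T" "length s = n" "length t = n" "length u = n"
      "forces_char_seq r (g j) \<xi> s" "forces_char_seq r (g j) \<eta> t"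
      "\<forall>i<n. forces_mem r (g j) (i, u ! i) \<zeta>"
      using met[of n] unfolding B'_def by blast
    then have "s = char_seq (val r g \<xi>) n" "t = char_seq (val r g \<eta>) n"
      using generic_seq_char_seq_eq[OF g dec(1)] generic_seq_char_seq_eq[OF g dec(2)] by metis+
    then show ?thesis using B by blast
  qed
  obtain u j where u: "\<And>n. length (u n) = n"
    "\<And>n. (char_seq (val r g \<xi>) n, char_seq (val r g \<eta>) n, u n) \<in> T"
    "\<And>n i. i < n \<Longrightarrow> forces_mem r (g (j n)) (i, u n ! i) \<zeta>"
    using ex by metis
  \<comment> \<open>Segments obtained from different conditions agree, since \<open>\<zeta>\<close>
    is forced to be single-valued.\<close>
  have coherent: "u n ! i = u m ! i" if "i < n" "i < m" for n m i
  proof -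
    let ?k = "max (j n) (j m)"
    have "forces_mem r (g ?k) (i, u n ! i) \<zeta>" "forces_mem r (g ?k) (i, u m ! i) \<zeta>"
      using u(3) that forces_mem_stronger generic_seq_mono[OF g]
      by (metis max.cobounded1, metis max.cobounded2)
    moreover have "(g ?k, q) \<in> r" using generic_seq_mono[OF g, of 0] g0 by simp
    moreover have "\<forall>i m m' q'. (q', q) \<in> r \<and> forces_mem r q' (i, m) \<zeta> \<and> forces_mem r q' (i, m') \<zeta>
        \<longrightarrow> m = m'"
      using B unfolding forces_branch_def forces_fun_def by (elim conjE)
    ultimately show ?thesis by blast
  qed
  define z where "z i = u (Suc i) ! i" for i
  have "u n = map z [0..<n]" for n
    by (rule nth_equalityI) (auto simp: u z_def intro: coherent)
  then have "(val r g \<xi>, val r g \<eta>) \<in> projection T"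
    unfolding projection_def using u(2) by auto
  moreover have "generic_seq r \<D> g" using g by (rule generic_seq_subset) (auto simp: \<D>'_def)
  ultimately show thesis using that g0 q by blast
qed

section \<open>Failure of membership in a projection: ranked trees and leftmost branches\<close>

definition refutes :: "code \<Rightarrow> (nat, 'p) name \<Rightarrow> (nat, 'p) name \<Rightarrow> 'p \<Rightarrow> nat list \<Rightarrow> bool" where
  "refutes T \<xi> \<eta> p u \<longleftrightarrow> (\<exists>s t. length s = length u \<and> length t = length u \<and>
     forces_char_seq r p \<xi> s \<and> forces_char_seq r p \<eta> t \<and> (s, t, u) \<notin> T)"

text \<open>
  A pre-fixed point \<open>W\<close> of this operator, equipped with a rank, consists of pairs \<open>(p, u)\<close> such that \<open>p\<close>
  forces the part above \<open>u\<close> of the tree of attempts to find a witness to be well-founded.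
\<close>

definition wf_step ::
  "code \<Rightarrow> (nat, 'p) name \<Rightarrow> (nat, 'p) name \<Rightarrow> ('p \<times> nat list) set \<Rightarrow> ('p \<times> nat list) set" where
  "wf_step T \<xi> \<eta> W =
     {(p, u). refutes T \<xi> \<eta> p u \<or> (\<forall>m. dense_below r p {d. (d, u @ [m]) \<in> W})}"

lemma mono_wf_step: "mono (wf_step T \<xi> \<eta>)"
  unfolding wf_step_def by (rule monoI) (auto elim!: dense_below_mono)

text \<open>Following \<open>z\<close>, the sequence either refutes the current node or meets the
  dense set that passes to the next node with smaller rank; as \<open>R\<close> is well-founded, a
  refutation occurs. The rank to be undercut belongs to the pair \<open>(p, u)\<close>, so the dense
  set depends on \<open>p\<close>.\<close>

lemma ranked_no_branch:
  assumes g: "generic_seq r \<D> g"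
    and dec: "\<And>a. (\<lambda>_. decides r \<xi> a) \<in> \<D>" "\<And>a. (\<lambda>_. decides r \<eta> a) \<in> \<D>"
    and "wf R"
    and ranked: "\<And>x. x \<in> W \<Longrightarrow> x \<in> wf_step T \<xi> \<eta> {y \<in> W. (y, x) \<in> R}"
    and D: "\<And>u m. (\<lambda>p. {d. (d, u @ [m]) \<in> W \<and> ((d, u @ [m]), (p, u)) \<in> R}) \<in> \<D>"
    and "(g i, map z [0..<n]) \<in> W"
  shows "\<exists>k. (char_seq (val r g \<xi>) k, char_seq (val r g \<eta>) k, map z [0..<k]) \<notin> T"
proof -
  have "\<exists>k. (char_seq (val r g \<xi>) k, char_seq (val r g \<eta>) k, map z [0..<k]) \<notin> T"
    if "x \<in> W" "x = (g i, map z [0..<n])" for x i n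
    using \<open>wf R\<close> that
  proof (induction x arbitrary: i n rule: wf_induct_rule)
    case (less x)
    let ?u = "map z [0..<n]"
    consider "refutes T \<xi> \<eta> (g i) ?u"
      | "dense_below r (g i) {d. (d, ?u @ [z n]) \<in> W \<and> ((d, ?u @ [z n]), x) \<in> R}"
      using ranked[OF less.prems(1)] less.prems(2) unfolding wf_step_def by auto
    then show ?case
    proof cases
      case 1
      then obtain s t where st: "length s = n" "length t = n" "(s, t, ?u) \<notin> T"
        "forces_char_seq r (g i) \<xi> s" "forces_char_seq r (g i) \<eta> t"
        unfolding refutes_def by auto
      then have "s = char_seq (val r g \<xi>) n" "t = char_seq (val r g \<eta>) n"
        using generic_seq_char_seq_eq[OF g dec(1)] generic_seq_char_seq_eq[OF g dec(2)] by metis+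
      then show ?thesis using st by blast
    next
      case 2
      then obtain j where j: "(g j, ?u @ [z n]) \<in> W" "((g j, ?u @ [z n]), x) \<in> R"
        using generic_seq_meets[OF g D, of i ?u "z n"] less.prems(2) by auto
      show ?thesis by (rule less.IH[OF j(2,1), of j "Suc n"]) simp
    qed
  qed
  then show ?thesis using assms(7) by blast
qed

text \<open>
  If no extension of \<open>p\<close> is paired with the empty sequence in a pre-fixed point \<open>W\<close>, then
  the leftmost branch of the tree \<open>{u. \<exists>p\<in>G. alive W p u}\<close> is forced to be a witness. It is definable
  from the generic filter, so no antichains are needed to name it.
\<close>

definition alive :: "('p \<times> nat list) set \<Rightarrow> 'p \<Rightarrow> nat list \<Rightarrow> bool" where
  "alive W p u \<longleftrightarrow> (\<forall>q. (q, p) \<in> r \<longrightarrow> (q, u) \<notin> W)"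

text \<open>Smaller siblings must be dead below every extension of \<open>p\<close>, which makes the
  notion persist to stronger conditions.\<close>

definition leftmost :: "('p \<times> nat list) set \<Rightarrow> 'p \<Rightarrow> nat list \<Rightarrow> bool" where
  "leftmost W p u \<longleftrightarrow> (\<forall>k<length u. alive W p (take (Suc k) u) \<and>
     (\<forall>m<u ! k. \<forall>q. (q, p) \<in> r \<longrightarrow> \<not> alive W q (take k u @ [m])))"

definition leftmost_name :: "('p \<times> nat list) set \<Rightarrow> (nat \<times> nat, 'p) name" where
  "leftmost_name W =
     {((k, m), p). p \<in> Field r \<and> (\<exists>u. length u = Suc k \<and> u ! k = m \<and> leftmost W p u)}"

lemma alive_stronger: "alive W p u \<Longrightarrow> (q, p) \<in> r \<Longrightarrow> alive W q u"
  unfolding alive_def by (blast intro: trans)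

lemma leftmost_stronger: "leftmost W p u \<Longrightarrow> (q, p) \<in> r \<Longrightarrow> leftmost W q u"
  unfolding leftmost_def by (blast intro: trans alive_stronger)

lemma leftmost_take: "leftmost W p u \<Longrightarrow> leftmost W p (take n u)"
  unfolding leftmost_def by (auto simp: min_def)

text \<open>At a first difference the smaller entry would be alive for one sequence and dead for the
  other.\<close>

lemma leftmost_unique:
  assumes "leftmost W p u" "leftmost W p v" "length u = length v" "p \<in> Field r"
  shows "u = v"
proof -
  have "take n u = take n v" if "n \<le> length u" for n
    using that
  proof (induction n)
    case (Suc n)
    then have eq: "take n u = take n v" and n: "n < length u" "n < length v"
      using assms(3) by auto
    have "\<not> u ! n < v ! n" "\<not> v ! n < u ! n"
      using assms n eq refl[OF assms(4)] unfolding leftmost_def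
      by (metis take_Suc_conv_app_nth)+
    then show ?case using eq n by (simp add: take_Suc_conv_app_nth)
  qed simp
  from this[of "length u"] show ?thesis using assms(3) by simp
qed

lemma leftmost_forces_mem:
  assumes "leftmost W p u" "i < length u"
  shows "forces_mem r p (i, u ! i) (leftmost_name W)"
proof -
  have "((i, u ! i), q) \<in> leftmost_name W" if "(q, p) \<in> r" for q
  proof -
    have "leftmost W q (take (Suc i) u)"
      using assms(1) that leftmost_take leftmost_stronger by blast
    moreover have "length (take (Suc i) u) = Suc i" "take (Suc i) u ! i = u ! i"
      using assms(2) by auto
    ultimately show ?thesis using that unfolding leftmost_name_def by (blast intro: FieldI1)
  qed
  then show ?thesis
    unfolding forces_mem_def dense_below_def by (blast intro: refl FieldI1)
qed

lemma forces_mem_leftmost_name: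
  assumes "forces_mem r p (i, m) (leftmost_name W)" "p \<in> Field r"
  obtains q u where "(q, p) \<in> r" "length u = Suc i" "u ! i = m" "leftmost W q u"
proof -
  obtain q s where q: "(q, p) \<in> r" "(q, s) \<in> r" "((i, m), s) \<in> leftmost_name W"
    using assms(1) refl[OF assms(2)] unfolding forces_mem_def dense_below_def by blast
  then obtain u where "length u = Suc i" "u ! i = m" "leftmost W s u"
    unfolding leftmost_name_def by blast
  then show thesis using that q leftmost_stronger by blast
qed

text \<open>An alive node lies outside \<open>W\<close>, hence outside
  \<open>wf_step T \<xi> \<eta> W\<close>; so for some child the conditions pairing it into
  \<open>W\<close> fail to be dense, and that child is alive below some extension.\<close>

lemma leftmost_dense:
  assumes W: "wf_step T \<xi> \<eta> W \<subseteq> W" and alive: "alive W p []" and q: "(q, p) \<in> r"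
  shows "\<exists>q' u. (q', q) \<in> r \<and> length u = n \<and> leftmost W q' u \<and> alive W q' u"
proof (induction n)
  case 0
  have "(q, q) \<in> r" using q by (auto intro: refl FieldI1)
  moreover have "leftmost W q []" by (simp add: leftmost_def)
  ultimately show ?case using alive_stronger[OF alive q] by blast
next
  case (Suc n)
  then obtain q' u where q': "(q', q) \<in> r" "length u = n" "leftmost W q' u" "alive W q' u" by blast
  have "(q', q') \<in> r" using q' by (auto intro: refl FieldI1)
  then have "(q', u) \<notin> W" using q'(4) by (simp add: alive_def)
  then have "(q', u) \<notin> wf_step T \<xi> \<eta> W" using W by blast
  then have ex: "\<exists>m d. (d, q') \<in> r \<and> alive W d (u @ [m])"
    unfolding wf_step_def dense_below_def alive_def by blast
  \<comment> \<open>The minimum is taken over all extensions of \<open>q'\<close>, so smaller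
    children stay dead below the chosen \<open>d\<close>.\<close>
  define m where "m = (LEAST m. \<exists>d. (d, q') \<in> r \<and> alive W d (u @ [m]))"
  obtain d where d: "(d, q') \<in> r" "alive W d (u @ [m])"
    using LeastI_ex[OF ex] unfolding m_def by blast
  have "\<not> alive W c (u @ [k])" if "(c, d) \<in> r" "k < m" for c k
    using not_less_Least[of k "\<lambda>m. \<exists>d. (d, q') \<in> r \<and> alive W d (u @ [m])"] that d(1) trans
    unfolding m_def by blast
  then have "leftmost W d (u @ [m])"
    using leftmost_stronger[OF q'(3) d(1)] d(2) unfolding leftmost_def
    by (auto simp: less_Suc_eq nth_append)
  then show ?case using d q' trans by (intro exI[of _ d] exI[of _ "u @ [m]"]) auto
qed

lemma leftmost_branch:
  assumes W: "wf_step T \<xi> \<eta> W \<subseteq> W" and alive: "alive W p []"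
  shows "forces_branch r T p \<xi> \<eta> (leftmost_name W)"
  unfolding forces_branch_def forces_fun_def
proof (intro conjI allI impI)
  fix i
  show "dense_below r p {q. \<exists>m. forces_mem r q (i, m) (leftmost_name W)}"
    unfolding dense_below_def
  proof (intro allI impI)
    fix q assume "(q, p) \<in> r"
    then obtain d u where d: "(d, q) \<in> r" "length u = Suc i" "leftmost W d u"
      using leftmost_dense[OF W alive, of q "Suc i"] by blast
    then have "forces_mem r d (i, u ! i) (leftmost_name W)" using leftmost_forces_mem by simp
    then show "\<exists>d\<in>{q. \<exists>m. forces_mem r q (i, m) (leftmost_name W)}. (d, q) \<in> r" using d(1) by blast
  qed
next
  fix i m m' q
  assume *: "(q, p) \<in> r \<and> forces_mem r q (i, m) (leftmost_name W) \<and>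
    forces_mem r q (i, m') (leftmost_name W)"
  then obtain d u where d: "(d, q) \<in> r" "length u = Suc i" "u ! i = m" "leftmost W d u"
    by (metis forces_mem_leftmost_name FieldI1)
  have "forces_mem r d (i, m') (leftmost_name W)" "d \<in> Field r"
    using * d(1) forces_mem_stronger by (auto intro: FieldI1)
  then obtain c v where c: "(c, d) \<in> r" "length v = Suc i" "v ! i = m'" "leftmost W c v"
    by (rule forces_mem_leftmost_name)
  have "u = v"
    using leftmost_unique[of W c u v] leftmost_stronger[OF d(4) c(1)] c d(2) by (auto intro: FieldI1)
  then show "m = m'" using c d by simp
next
  fix n
  show "dense_below r p
        {q. \<exists>(s, t, u)\<in>T. length s = n \<and> length t = n \<and> length u = n \<and>
              forces_char_seq r q \<xi> s \<and> forces_char_seq r q \<eta> t \<and>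
              (\<forall>i<n. forces_mem r q (i, u ! i) (leftmost_name W))}" (is "dense_below r p ?B")
    unfolding dense_below_def
  proof (intro allI impI)
    fix q assume "(q, p) \<in> r"
    then obtain a u where a: "(a, q) \<in> r" "length u = n" "leftmost W a u" "alive W a u"
      using leftmost_dense[OF W alive] by blast
    obtain b s where b: "(b, a) \<in> r" "length s = n" "forces_char_seq r b \<xi> s"
      using forces_char_seq_exists[of a] a(1) by (metis FieldI1)
    obtain c t where c: "(c, b) \<in> r" "length t = n" "forces_char_seq r c \<eta> t"
      using forces_char_seq_exists[of b] b(1) by (metis FieldI1)
    have ca: "(c, a) \<in> r" using b c trans by blast
    have s: "forces_char_seq r c \<xi> s" using b(3) c(1) by (rule forces_char_seq_stronger)
    \<comment> \<open>\<open>c\<close> decides both segments and \<open>W\<close> absorbs every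
      refuted pair, so an alive node must lie in the tree.\<close>
    have "(c, u) \<notin> wf_step T \<xi> \<eta> W" using a(4) ca W by (auto simp: alive_def)
    then have "(s, t, u) \<in> T" using a b c s unfolding wf_step_def refutes_def by blast
    moreover have "\<forall>i<n. forces_mem r c (i, u ! i) (leftmost_name W)"
      using leftmost_forces_mem leftmost_stronger[OF a(3) ca] a(2) by blast
    ultimately have "c \<in> ?B" using a b c s by blast
    then show "\<exists>d\<in>?B. (d, q) \<in> r" using ca a(1) trans by blast
  qed
qed

lemma is_name_leftmost_name: "is_name r (leftmost_name W)"
  by (auto simp: is_name_def leftmost_name_def)

text \<open>Below some \<open>q\<close> no condition has a witness name, so the leftmost branch
  fails to be one and the root is not alive. A sequence through a condition paired with the root in
  \<open>W\<close> then inherits well-foundedness.\<close>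

lemma not_forces_projection_generic:
  assumes F: "\<not> forces_projection r T p \<xi> \<eta>" and \<D>: "countable \<D>"
  obtains g where "generic_seq r \<D> g" "(g 0, p) \<in> r" "(val r g \<xi>, val r g \<eta>) \<notin> projection T"
proof -
  obtain W R where "wf R" and W: "wf_step T \<xi> \<eta> W \<subseteq> W"
    and ranked: "\<And>x. x \<in> W \<Longrightarrow> x \<in> wf_step T \<xi> \<eta> {y \<in> W. (y, x) \<in> R}"
    using ranked_prefixpoint[OF mono_wf_step, of T \<xi> \<eta>] by blast
  obtain q where q: "(q, p) \<in> r"
    "\<And>d \<zeta>. (d, q) \<in> r \<Longrightarrow> is_name r \<zeta> \<Longrightarrow> \<not> forces_branch r T d \<xi> \<eta> \<zeta>"
    using F unfolding forces_projection_def dense_below_def by blast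
  then have "\<not> alive W q []"
    using leftmost_branch[OF W] is_name_leftmost_name refl by (metis FieldI1)
  then obtain d where d: "(d, q) \<in> r" "(d, []) \<in> W" unfolding alive_def by blast
  define \<D>' where "\<D>' = \<D> \<union> range (\<lambda>a _. decides r \<xi> a) \<union> range (\<lambda>a _. decides r \<eta> a) \<union>
    range (\<lambda>(u, m) p. {d. (d, u @ [m]) \<in> W \<and> ((d, u @ [m]), (p, u)) \<in> R})"
  have "countable \<D>'" using \<D> by (auto simp: \<D>'_def)
  then obtain g where g0: "g 0 = d" and g: "generic_seq r \<D>' g"
    using generic_seq_exists[of d] d by (metis FieldI1)
  have "\<exists>k. (char_seq (val r g \<xi>) k, char_seq (val r g \<eta>) k, map z [0..<k]) \<notin> T" for z
  proof (rule ranked_no_branch[OF g _ _ \<open>wf R\<close> ranked])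
    show "(\<lambda>p. {d. (d, u @ [m]) \<in> W \<and> ((d, u @ [m]), (p, u)) \<in> R}) \<in> \<D>'" for u m
      unfolding \<D>'_def by (intro UnI2 image_eqI[of _ _ "(u, m)"]) auto
    show "(g 0, map z [0..<0]) \<in> W" using d g0 by simp
  qed (auto simp: \<D>'_def)
  then have "(val r g \<xi>, val r g \<eta>) \<notin> projection T" by (auto simp: projection_def)
  moreover have "generic_seq r \<D> g" using g by (rule generic_seq_subset) (auto simp: \<D>'_def)
  ultimately show thesis using that g0 d q trans by blast
qed

end


section \<open>Products\<close>

lemma Field_prod_forcing [simp]: "Field (prod_forcing r s) = Field r \<times> Field s"
  if "forcing r" "forcing s"
  using forcing.refl[OF that(1)] forcing.refl[OF that(2)]
  by (auto simp: prod_forcing_def Field_def Domain.simps Range.simps) blast+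

lemma mem_prod_forcing [simp]:
  "((p', q'), (p, q)) \<in> prod_forcing r s \<longleftrightarrow> (p', p) \<in> r \<and> (q', q) \<in> s"
  by (auto simp: prod_forcing_def)

lemma forcing_prod: "forcing r \<Longrightarrow> forcing s \<Longrightarrow> forcing (prod_forcing r s)"
  by (rule forcing.intro)
    (auto simp: preorder_on_def refl_on_def trans_def FieldI1 FieldI2
      intro: forcing.refl elim: forcing.trans)

context
  fixes r :: "('p \<times> 'p) set" and s :: "('q \<times> 'q) set"
  assumes r: "forcing r" and s: "forcing s"
begin

lemma forces_mem_left:
  "q \<in> Field s \<Longrightarrow> forces_mem (prod_forcing r s) (p, q) a (left_name s \<xi>) \<longleftrightarrow> forces_mem r p a \<xi>"
  using forcing.refl[OF s]
  by (auto simp: forces_mem_def dense_below_def left_name_def; blast intro: FieldI1)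

lemma forces_mem_right:
  "p \<in> Field r \<Longrightarrow> forces_mem (prod_forcing r s) (p, q) a (right_name r \<xi>) \<longleftrightarrow> forces_mem s q a \<xi>"
  using forcing.refl[OF r]
  by (auto simp: forces_mem_def dense_below_def right_name_def; blast intro: FieldI1)

lemma forces_not_mem_left:
  "q \<in> Field s \<Longrightarrow>
     forces_not_mem (prod_forcing r s) (p, q) a (left_name s \<xi>) \<longleftrightarrow> forces_not_mem r p a \<xi>"
  using forcing.refl[OF s] forces_mem_left[of _ _ a \<xi>]
  unfolding forces_not_mem_def split_paired_All mem_prod_forcing by (metis FieldI1)

lemma forces_not_mem_right:
  "p \<in> Field r \<Longrightarrow>
     forces_not_mem (prod_forcing r s) (p, q) a (right_name r \<xi>) \<longleftrightarrow> forces_not_mem s q a \<xi>"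
  using forcing.refl[OF r] forces_mem_right[of _ _ a \<xi>]
  unfolding forces_not_mem_def split_paired_All mem_prod_forcing by (metis FieldI1)

lemma forces_char_seq_left:
  "q \<in> Field s \<Longrightarrow>
     forces_char_seq (prod_forcing r s) (p, q) (left_name s \<xi>) t \<longleftrightarrow> forces_char_seq r p \<xi> t"
  unfolding forces_char_seq_def by (simp add: forces_mem_left forces_not_mem_left)

lemma forces_char_seq_right:
  "p \<in> Field r \<Longrightarrow>
     forces_char_seq (prod_forcing r s) (p, q) (right_name r \<xi>) t \<longleftrightarrow> forces_char_seq s q \<xi> t"
  unfolding forces_char_seq_def by (simp add: forces_mem_right forces_not_mem_right)

end

lemma (in forcing) forces_char_seq_check_name:
  assumes p: "p \<in> Field r"
  shows "forces_char_seq r p (check_name r x) s \<longleftrightarrow> s = char_seq x (length s)"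
proof -
  have mem: "forces_mem r q a (check_name r x) \<longleftrightarrow> a \<in> x" if "q \<in> Field r" for q a
    using refl that
    unfolding forces_mem_def dense_below_def check_name_def by (blast intro: FieldI1)
  have "forces_not_mem r p a (check_name r x) \<longleftrightarrow> a \<notin> x" for a
    using refl[OF p] mem unfolding forces_not_mem_def by (blast intro: FieldI1)
  then show ?thesis
    using mem[OF p] by (auto simp: forces_char_seq_def list_eq_iff_nth_eq)
qed


section \<open>Submeasures\<close>

definition disagree :: "bool list \<Rightarrow> bool list \<Rightarrow> nat set" where
  "disagree s t = {j. j < length s \<and> s ! j \<noteq> t ! j}"

lemma disagree_char_seq: "disagree (char_seq x n) (char_seq y n) = sym_diff x y \<inter> {..<n}"
  by (auto simp: disagree_def)

lemma disagree_triangle: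
  "length s = length u \<Longrightarrow> disagree s t \<subseteq> disagree s u \<union> disagree u t"
  by (auto simp: disagree_def)

lemma disagree_commute: "length s = length t \<Longrightarrow> disagree s t = disagree t s"
  by (auto simp: disagree_def)

lemma Exh_iff: "X \<in> Exh \<phi> \<longleftrightarrow> (\<forall>e>0. \<exists>n. \<forall>i\<ge>n. \<phi> i X \<le> ennreal e)"
proof -
  have "X \<in> Exh \<phi> \<longleftrightarrow> limsup (\<lambda>i. \<phi> i X) \<le> 0" by (simp add: Exh_def)
  also have "\<dots> \<longleftrightarrow> (\<forall>y>0. \<exists>n. \<forall>i\<ge>n. \<phi> i X < y)"
    unfolding Limsup_le_iff eventually_sequentially ..
  also have "\<dots> \<longleftrightarrow> (\<forall>e>0. \<exists>n. \<forall>i\<ge>n. \<phi> i X \<le> ennreal e)"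
  proof (intro iffI allI impI)
    fix e :: real
    assume "\<forall>y>0. \<exists>n. \<forall>i\<ge>n. \<phi> i X < y" "0 < e"
    then show "\<exists>n. \<forall>i\<ge>n. \<phi> i X \<le> ennreal e" by (metis ennreal_less_zero_iff less_imp_le)
  next
    fix y :: ennreal
    assume small: "\<forall>e>0. \<exists>n. \<forall>i\<ge>n. \<phi> i X \<le> ennreal e" and "0 < y"
    \<comment> \<open>\<open>y\<close> may be infinite; a point strictly below it is real and also
      turns the weak bound into a strict one.\<close>
    then obtain z where z: "0 < z" "z < y" using dense by blast
    then obtain e where "z = ennreal e" "0 < e" by (cases z) auto
    then show "\<exists>n. \<forall>i\<ge>n. \<phi> i X < y" using small z by (meson le_less_trans)
  qed
  finally show ?thesis .
qed

lemma Exh_iff_inverse: "X \<in> Exh \<phi> \<longleftrightarrow> (\<forall>k. \<exists>n. \<forall>i\<ge>n. \<phi> i X \<le> ennreal (inverse (Suc k)))"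
  unfolding Exh_iff
proof (intro iffI allI impI)
  fix e :: real
  assume small: "\<forall>k. \<exists>n. \<forall>i\<ge>n. \<phi> i X \<le> ennreal (inverse (Suc k))" and "0 < e"
  then obtain k where "inverse (real (Suc k)) < e" using reals_Archimedean by blast
  then show "\<exists>n. \<forall>i\<ge>n. \<phi> i X \<le> ennreal e"
    using small by (meson ennreal_leI less_imp_le order_trans)
qed simp

text \<open>Expresses that \<open>p\<close> forces \<phi>_i of the symmetric difference to be at
  most \<open>e\<close> for all \<open>i \<ge> n\<close>. For lower semicontinuous submeasures the
  decided finite segments suffice.\<close>

definition forces_close ::
  "(nat \<Rightarrow> nat set \<Rightarrow> ennreal) \<Rightarrow> ('p \<times> 'p) set \<Rightarrow> 'p \<Rightarrow> (nat, 'p) name \<Rightarrow> (nat, 'p) name \<Rightarrow>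
    nat \<Rightarrow> real \<Rightarrow> bool" where
  "forces_close \<phi> r p \<xi> \<eta> n e \<longleftrightarrow> (\<forall>q s t i. (q, p) \<in> r \<longrightarrow> length s = length t \<longrightarrow>
     forces_char_seq r q \<xi> s \<longrightarrow> forces_char_seq r q \<eta> t \<longrightarrow> n \<le> i \<longrightarrow>
     \<phi> i (disagree s t) \<le> ennreal e)"

section \<open>Lower semicontinuous submeasures: equivalence, analyticity, forced bounds\<close>

locale lsc_submeasures =
  fixes \<phi> :: "nat \<Rightarrow> nat set \<Rightarrow> ennreal"
  assumes submeasure: "\<And>i. submeasure (\<phi> i)"
    and lsc: "\<And>i. lower_semicontinuous (\<phi> i)"
begin

lemma empty: "\<phi> i {} = 0"
  using submeasure by (simp add: submeasure_def)

lemma mono: "x \<subseteq> y \<Longrightarrow> \<phi> i x \<le> \<phi> i y"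
  using submeasure[of i] unfolding submeasure_def by (metis sup.absorb2)

lemma subadditive: "x \<subseteq> y \<union> z \<Longrightarrow> \<phi> i x \<le> \<phi> i y + \<phi> i z"
  using submeasure[of i] mono unfolding submeasure_def by (meson order_trans)

lemma le_iff_initial: "\<phi> i x \<le> c \<longleftrightarrow> (\<forall>n. \<phi> i (x \<inter> {..<n}) \<le> c)"
  using lsc[of i] unfolding lower_semicontinuous_def by (metis SUP_le_iff UNIV_I)

lemma triangle:
  assumes "x \<subseteq> y \<union> z" "\<phi> i y \<le> ennreal (e / 2)" "\<phi> i z \<le> ennreal (e / 2)" "0 < e"
  shows "\<phi> i x \<le> ennreal e"
proof -
  have "\<phi> i x \<le> ennreal (e / 2) + ennreal (e / 2)"
    using subadditive[OF assms(1)] add_mono[OF assms(2,3)] by (rule order_trans)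
  also have "\<dots> = ennreal e" using assms(4) by (simp flip: ennreal_plus)
  finally show ?thesis .
qed

lemma equiv_E_of_Exh: "equiv UNIV (E_of (Exh \<phi>))"
proof (rule equivI)
  show "refl (E_of (Exh \<phi>))" by (auto simp: refl_on_def E_of_def Exh_iff empty)
  show "sym (E_of (Exh \<phi>))" by (auto simp: sym_def E_of_def Un_commute)
  show "trans (E_of (Exh \<phi>))"
  proof (rule transI, unfold E_of_def, clarify)
    fix x y z
    assume xy: "sym_diff x y \<in> Exh \<phi>" and yz: "sym_diff y z \<in> Exh \<phi>"
    have "\<exists>n. \<forall>i\<ge>n. \<phi> i (sym_diff x z) \<le> ennreal e" if "0 < e" for e
    proof -
      have "0 < e / 2" using that by simp
      then obtain n m where "\<forall>i\<ge>n. \<phi> i (sym_diff x y) \<le> ennreal (e / 2)"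
        "\<forall>i\<ge>m. \<phi> i (sym_diff y z) \<le> ennreal (e / 2)"
        using xy yz unfolding Exh_iff by meson
      then have "\<forall>i\<ge>max n m. \<phi> i (sym_diff x z) \<le> ennreal e"
        using that by (auto intro!: triangle[of "sym_diff x z" "sym_diff x y" "sym_diff y z"])
      then show ?thesis by blast
    qed
    then show "sym_diff x z \<in> Exh \<phi>" by (simp add: Exh_iff)
  qed
qed simp

lemma analytic_E_of_Exh: "analytic (E_of (Exh \<phi>))"
proof -
  define T :: code where "T = {(s, t, u). \<forall>k<length u. \<forall>i\<ge>u ! k.
    \<phi> i (disagree s t) \<le> ennreal (inverse (Suc k))}"
  text \<open>The witness maps \<open>k\<close> to an index from which the submeasures are at most \<open>1/(k+1)\<close>.\<close>
  have "(x, y) \<in> projection T \<longleftrightarrow> (x, y) \<in> E_of (Exh \<phi>)" for x y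
  proof -
    have "(\<forall>n. (char_seq x n, char_seq y n, map z [0..<n]) \<in> T) \<longleftrightarrow>
        (\<forall>k. \<forall>i\<ge>z k. \<phi> i (sym_diff x y) \<le> ennreal (inverse (Suc k)))" for z
    proof -
      have "(\<forall>n. (char_seq x n, char_seq y n, map z [0..<n]) \<in> T) \<longleftrightarrow>
        (\<forall>k. \<forall>i\<ge>z k. \<forall>n>k. \<phi> i (sym_diff x y \<inter> {..<n}) \<le> ennreal (inverse (Suc k)))"
        by (auto simp: T_def disagree_char_seq simp del: of_nat_Suc)
      also have "\<dots> \<longleftrightarrow> (\<forall>k. \<forall>i\<ge>z k. \<phi> i (sym_diff x y) \<le> ennreal (inverse (Suc k)))"
      proof -
        \<comment> \<open>Entry \<open>k\<close> of the witness is visible only in segments longer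
          than \<open>k\<close>; by monotonicity these control the shorter ones.\<close>
        have "(\<forall>n>k. \<phi> i (a \<inter> {..<n}) \<le> c) \<longleftrightarrow> \<phi> i a \<le> c" for k i a c
        proof
          assume *: "\<forall>n>k. \<phi> i (a \<inter> {..<n}) \<le> c"
          have "\<phi> i (a \<inter> {..<n}) \<le> \<phi> i (a \<inter> {..<max n (Suc k)})" for n by (rule mono) auto
          then show "\<phi> i a \<le> c" using * le_iff_initial[of i a c]
            by (meson less_max_iff_disj lessI order_trans)
        qed (use le_iff_initial[of i a c] in blast)
        then show ?thesis by simp
      qed
      finally show ?thesis .
    qed
    then show ?thesis
      unfolding projection_def E_of_def Exh_iff_inverse by (simp add: choice_iff)
  qed
  then show ?thesis unfolding analytic_def by (intro exI[of _ T]) auto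
qed

text \<open>Otherwise, for every \<open>n\<close>, conditions deciding a finite part with value
  above \<open>e\<close> at some index \<open>i \<ge> n\<close> are dense below \<open>p\<close>. A
  sequence meeting all of them has equivalent values, a contradiction.\<close>

lemma forces_projection_imp_close:
  assumes "forcing r" and T: "projection T = E_of (Exh \<phi>)"
    and F: "forces_projection r T p \<xi> \<eta>" and p: "p \<in> Field r" and e: "0 < e"
  shows "\<exists>q n. (q, p) \<in> r \<and> forces_close \<phi> r q \<xi> \<eta> n e"
proof (rule ccontr)
  assume not_close: "\<not> ?thesis"
  interpret forcing r by fact
  define D where "D n = {d. \<exists>s t i. length s = length t \<and> forces_char_seq r d \<xi> s \<and>
    forces_char_seq r d \<eta> t \<and> n \<le> i \<and> \<not> \<phi> i (disagree s t) \<le> ennreal e}" for n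
  have dense: "dense_below r p (D n)" for n
    using not_close unfolding dense_below_def D_def forces_close_def by blast
  define \<D> where "\<D> = range (\<lambda>a _. decides r \<xi> a) \<union> range (\<lambda>a _. decides r \<eta> a) \<union>
    range (\<lambda>n (_::'a). D n)"
  have "countable \<D>" by (simp add: \<D>_def)
  then obtain g where g: "generic_seq r \<D> g" "(g 0, p) \<in> r"
    "(val r g \<xi>, val r g \<eta>) \<in> E_of (Exh \<phi>)"
    using forces_projection_generic[OF F p] T by metis
  then obtain n where n: "\<forall>i\<ge>n. \<phi> i (sym_diff (val r g \<xi>) (val r g \<eta>)) \<le> ennreal e"
    using e unfolding E_of_def Exh_iff by blast
  have dec: "\<And>a. (\<lambda>_. decides r \<xi> a) \<in> \<D>" "\<And>a. (\<lambda>_. decides r \<eta> a) \<in> \<D>"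
    "(\<lambda>_. D n) \<in> \<D>"
    by (auto simp: \<D>_def)
  obtain j where "g j \<in> D n"
    using generic_seq_meets[OF g(1) dec(3), of 0] dense_below_stronger[OF dense g(2)] by blast
  then obtain s t i where st: "length s = length t" "forces_char_seq r (g j) \<xi> s"
    "forces_char_seq r (g j) \<eta> t" "n \<le> i" "\<not> \<phi> i (disagree s t) \<le> ennreal e"
    unfolding D_def by blast
  have "disagree s t \<subseteq> sym_diff (val r g \<xi>) (val r g \<eta>)"
    using generic_seq_char_seq_eq[OF g(1) dec(1) st(2)] st(1)
      generic_seq_char_seq_eq[OF g(1) dec(2) st(3)] disagree_char_seq by (metis inf.cobounded1)
  then show False using mono n st(4,5) order_trans by blast
qed

text \<open>Otherwise some sequence has inequivalent values while meeting bounds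
  \<open>1/(k+1)\<close> for all \<open>k\<close>; these bound all finite parts, hence the whole
  difference by lower semicontinuity.\<close>

lemma forces_projection_if_close:
  assumes "forcing r" and T: "projection T = E_of (Exh \<phi>)"
    and close: "\<And>q e. (q, p) \<in> r \<Longrightarrow> 0 < e \<Longrightarrow> \<exists>d n. (d, q) \<in> r \<and> forces_close \<phi> r d \<xi> \<eta> n e"
  shows "forces_projection r T p \<xi> \<eta>"
proof (rule ccontr)
  assume F: "\<not> ?thesis"
  interpret forcing r by fact
  define C where "C k = {d. \<exists>n. forces_close \<phi> r d \<xi> \<eta> n (inverse (Suc k))}" for k :: nat
  have dense: "dense_below r p (C k)" for k
    using close unfolding dense_below_def C_def
    by (metis inverse_positive_iff_positive mem_Collect_eq of_nat_0_less_iff zero_less_Suc)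
  define \<D> where "\<D> = range (\<lambda>a _. decides r \<xi> a) \<union> range (\<lambda>a _. decides r \<eta> a) \<union>
    range (\<lambda>n (_::'a). C n)"
  have "countable \<D>" by (simp add: \<D>_def)
  then obtain g where g: "generic_seq r \<D> g" "(g 0, p) \<in> r"
    "(val r g \<xi>, val r g \<eta>) \<notin> E_of (Exh \<phi>)"
    using not_forces_projection_generic[OF F] T by metis
  have dec: "\<And>a. (\<lambda>_. decides r \<xi> a) \<in> \<D>" "\<And>a. (\<lambda>_. decides r \<eta> a) \<in> \<D>"
    "\<And>k. (\<lambda>_. C k) \<in> \<D>"
    by (auto simp: \<D>_def)
  let ?X = "sym_diff (val r g \<xi>) (val r g \<eta>)"
  have "\<exists>n. \<forall>i\<ge>n. \<phi> i ?X \<le> ennreal (inverse (Suc k))" for k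
  proof -
    obtain j n where C: "forces_close \<phi> r (g j) \<xi> \<eta> n (inverse (Suc k))"
      using generic_seq_meets[OF g(1) dec(3), of 0] dense_below_stronger[OF dense g(2)]
      unfolding C_def by blast
    have "\<phi> i (?X \<inter> {..<m}) \<le> ennreal (inverse (Suc k))" if "n \<le> i" for i m
    proof -
      obtain a b where ab: "forces_char_seq r (g a) \<xi> (char_seq (val r g \<xi>) m)"
        "forces_char_seq r (g b) \<eta> (char_seq (val r g \<eta>) m)"
        using generic_seq_char_seq[OF g(1) dec(1)] generic_seq_char_seq[OF g(1) dec(2)] by blast
      let ?l = "max j (max a b)"
      have "(g ?l, g j) \<in> r" "(g ?l, g a) \<in> r" "(g ?l, g b) \<in> r"
        using generic_seq_mono[OF g(1)] by simp_all
      then show ?thesis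
        using C ab that forces_char_seq_stronger unfolding forces_close_def
        by (metis disagree_char_seq length_char_seq)
    qed
    then show ?thesis using le_iff_initial by blast
  qed
  then show False using g(3) by (simp add: E_of_def Exh_iff_inverse)
qed

section \<open>Pinning a virtual class\<close>

lemma virtual_class_imp_pinned_class:
  assumes "forcing r" and "r \<noteq> {}" and T: "projection T = E_of (Exh \<phi>)"
    and virtual: "virtual_class r T \<xi>"
  shows "pinned_class r T \<xi>"
proof -
  interpret forcing r by fact
  interpret prod: forcing "prod_forcing r r" using \<open>forcing r\<close> by (simp add: forcing_prod)
  define close where "close p q n e \<longleftrightarrow>
    forces_close \<phi> (prod_forcing r r) (p, q) (left_name r \<xi>) (right_name r \<xi>) n e" for p q n e
  \<comment> \<open>In the product the two copies are decided independently, so segments forced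
    below \<open>p\<close> and below \<open>q\<close> can be compared directly.\<close>
  have closeD: "\<phi> i (disagree s t) \<le> ennreal e"
    if "close p q n e" "(p', p) \<in> r" "(q', q) \<in> r" "length s = length t"
      "forces_char_seq r p' \<xi> s" "forces_char_seq r q' \<xi> t" "n \<le> i" for p q n e p' q' s t i
  proof -
    have "p' \<in> Field r" "q' \<in> Field r" using that by (auto intro: FieldI1)
    then show ?thesis
      using that unfolding close_def forces_close_def
      by (metis forces_char_seq_left forces_char_seq_right \<open>forcing r\<close> mem_prod_forcing)
  qed
  have close_ex: "\<exists>p' q' n. (p', p) \<in> r \<and> (q', q) \<in> r \<and> close p' q' n e"
    if "p \<in> Field r" "q \<in> Field r" "0 < e" for p q e
  proof -
    have "(p, q) \<in> Field (prod_forcing r r)" using that \<open>forcing r\<close> by simp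
    then have "\<exists>d n. (d, (p, q)) \<in> prod_forcing r r \<and>
        forces_close \<phi> (prod_forcing r r) d (left_name r \<xi>) (right_name r \<xi>) n e"
      using virtual that(3) forces_projection_imp_close[OF prod.forcing_axioms T]
      unfolding virtual_class_def by blast
    then show ?thesis unfolding close_def by auto
  qed
  have diagonal: "\<exists>p' n. (p', p) \<in> r \<and> close p' p' n e" if p: "p \<in> Field r" and e: "0 < e" for p e
  proof -
    obtain p' q n where c: "(p', p) \<in> r" "(q, p) \<in> r" "close p' q n (e / 2)"
      using close_ex[of p p "e / 2"] p e by auto
    then have q: "q \<in> Field r" by (auto intro: FieldI1)
    have "close p' p' n e"
      unfolding close_def forces_close_def
    proof (intro allI impI)
      fix d s t i
      assume d: "(d, (p', p')) \<in> prod_forcing r r" and len: "length s = length t"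
        and s: "forces_char_seq (prod_forcing r r) d (left_name r \<xi>) s"
        and t: "forces_char_seq (prod_forcing r r) d (right_name r \<xi>) t" and i: "n \<le> i"
      obtain a b where ab: "d = (a, b)" "(a, p') \<in> r" "(b, p') \<in> r" using d by (cases d) auto
      then have "a \<in> Field r" "b \<in> Field r" by (auto intro: FieldI1)
      then have s: "forces_char_seq r a \<xi> s" and t: "forces_char_seq r b \<xi> t"
        using s t ab \<open>forcing r\<close> by (simp_all add: forces_char_seq_left forces_char_seq_right)
      \<comment> \<open>\<open>u\<close> is a segment of the third copy; both \<open>a\<close> and
        \<open>b\<close> lie below \<open>p'\<close>, so \<open>s\<close> and \<open>t\<close> are
        each \<open>e / 2\<close>-close to it.\<close>
      obtain q' u where u: "(q', q) \<in> r" "length u = length s" "forces_char_seq r q' \<xi> u"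
        using forces_char_seq_exists[OF q] by blast
      have "\<phi> i (disagree s u) \<le> ennreal (e / 2)"
        using closeD[OF c(3) ab(2) u(1) _ s u(3) i] u(2) by simp
      moreover have "\<phi> i (disagree u t) \<le> ennreal (e / 2)"
        using closeD[OF c(3) ab(3) u(1) _ t u(3) i] u(2) len by (simp add: disagree_commute)
      ultimately show "\<phi> i (disagree s t) \<le> ennreal e"
        using disagree_triangle[of s u t] u(2) e by (auto intro: triangle)
    qed
    then show ?thesis using c(1) by blast
  qed
  define C where "C k = {p. \<exists>n. close p p n (inverse (Suc k))}" for k :: nat
  have dense: "dense_below r p (C k)" for p k
    unfolding dense_below_def
  proof (intro allI impI)
    fix q assume "(q, p) \<in> r"
    then have "q \<in> Field r" by (rule FieldI1)
    then show "\<exists>d\<in>C k. (d, q) \<in> r" using diagonal[of q "inverse (Suc k)"] by (auto simp: C_def)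
  qed
  define \<D> where "\<D> = range (\<lambda>a _. decides r \<xi> a) \<union> range (\<lambda>k (_::'a). C k)"
  have "countable \<D>" by (simp add: \<D>_def)
  moreover obtain p0 where "p0 \<in> Field r" using \<open>r \<noteq> {}\<close> by (auto simp: Field_def)
  ultimately obtain g where g: "generic_seq r \<D> g" using generic_seq_exists by metis
  have dec: "\<And>a. (\<lambda>_. decides r \<xi> a) \<in> \<D>" "\<And>k. (\<lambda>_. C k) \<in> \<D>" by (auto simp: \<D>_def)
  define x where "x = val r g \<xi>"
  have "forces_projection r T p (check_name r x) \<xi>" if "p \<in> Field r" for p
  proof (rule forces_projection_if_close[OF \<open>forcing r\<close> T])
    fix q and e :: real assume q: "(q, p) \<in> r" and e: "0 < e"
    obtain k where k: "inverse (real (Suc k)) < e / 2" using reals_Archimedean[of "e / 2"] e by auto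
    obtain j n where jn: "close (g j) (g j) n (inverse (Suc k))"
      using generic_seq_meets[OF g dec(2) dense] unfolding C_def by blast
    \<comment> \<open>A copy below \<open>l\<close> mediates: it is close to \<xi> below
      \<open>q'\<close> by the virtual class property, and close to \<open>x\<close> because
      \<open>l\<close> is below \<open>g j\<close>.\<close>
    obtain q' l m where c: "(q', q) \<in> r" "(l, g j) \<in> r" "close q' l m (e / 2)"
      using close_ex[of q "g j" "e / 2"] q e generic_seq_in_Field[OF g] by (auto intro: FieldI1)
    have "forces_close \<phi> r q' (check_name r x) \<xi> (max n m) e"
      unfolding forces_close_def
    proof (intro allI impI)
      fix d s t i
      assume d: "(d, q') \<in> r" and len: "length s = length t"
        and s: "forces_char_seq r d (check_name r x) s" and t: "forces_char_seq r d \<xi> t"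
        and i: "max n m \<le> i"
      have "s = char_seq x (length s)" using s d forces_char_seq_check_name by (metis FieldI1)
      then obtain a where a: "forces_char_seq r (g a) \<xi> s"
        using generic_seq_char_seq[OF g dec(1)] x_def by metis
      \<comment> \<open>The condition must both force \<open>s\<close> and lie below
        \<open>g j\<close>, where the diagonal bound applies.\<close>
      have a': "forces_char_seq r (g (max j a)) \<xi> s" "(g (max j a), g j) \<in> r"
        using a forces_char_seq_stronger generic_seq_mono[OF g] by (metis max.cobounded2, simp)
      obtain l' u where u: "(l', l) \<in> r" "length u = length s" "forces_char_seq r l' \<xi> u"
        using forces_char_seq_exists[of l] c(2) by (metis FieldI1)
      have "\<phi> i (disagree s u) \<le> ennreal (inverse (Suc k))"
        using closeD[OF jn a'(2) trans[OF u(1) c(2)] _ a'(1) u(3)] u(2) i by simp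
      then have "\<phi> i (disagree s u) \<le> ennreal (e / 2)"
        using k by (meson ennreal_leI less_imp_le order_trans)
      moreover have "\<phi> i (disagree u t) \<le> ennreal (e / 2)"
        using closeD[OF c(3) d u(1) _ t u(3)] u(2) len i by (simp add: disagree_commute)
      ultimately show "\<phi> i (disagree s t) \<le> ennreal e"
        using disagree_triangle[of s u t] u(2) e by (auto intro: triangle)
    qed
    then show "\<exists>d n. (d, q) \<in> r \<and> forces_close \<phi> r d (check_name r x) \<xi> n e" using c(1) by blast
  qed
  then show ?thesis unfolding pinned_class_def by blast
qed

end

theorem theorem4p8:
  fixes \<phi> :: "nat \<Rightarrow> nat set \<Rightarrow> ennreal"
  assumes "\<And>i. submeasure (\<phi> i)"
    and "\<And>i. lower_semicontinuous (\<phi> i)"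
  shows "pinned TYPE('p) (E_of (Exh \<phi>))"
proof -
  interpret lsc_submeasures \<phi> using assms by unfold_locales
  have "pinned_class r T \<xi>"
    if "E_of (Exh \<phi>) = projection T" "forcing_notion r" "virtual_class r T \<xi>"
    for T :: code and r :: "('p \<times> 'p) set" and \<xi>
    using that virtual_class_imp_pinned_class[of r T \<xi>]
    by (auto simp: forcing_notion_def forcing_def)
  then show ?thesis
    unfolding pinned_def using equiv_E_of_Exh analytic_E_of_Exh by blast
qed

end
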